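(* Let $N\ge1$. The crossing matrix map takes the subgroup $\mathfrak{P}_N$ of pure $N$-strand braids onto the additive group $\mathfrak{S}^0_N[\mathbf{Z}]$ of $N\times N$ symmetric integer matrices with zero diagonal: $\mathcal{C}(\mathfrak{P}_N)=\mathfrak{S}^0_N[\mathbf{Z}]$.
   Context: $\mathfrak{B}_N$ is the $N$-strand braid group with standard Artin generators $\sigma_1,\dots,\sigma_{N-1}$. Braids are drawn going downward; the product $ab$ is $a$ followed (below) by $b$. Strands are numbered $1,\dots,N$ from left to right by their starting positions. A crossing is positive if the strand that is on the left just before the crossing passes over the one on the right (this is $\sigma_i$, at positions $i,i+1$), and negative if the right strand passes over the left one ($\sigma_i^{-1}$). The crossing matrix $\mathcal{C}(b)$ of $b\in\mathfrak{B}_N$ is the $N\times N$ integer matrix with zero diagonal whose $(i,j)$ entry ($i\ne j$) is the number of positive crossings in which strand $i$ passes over strand $j$ minus the number of negative crossings in which strand $i$ passes over strand $j$; it depends only on the braid $b$. The permutation of $b$ sends the starting position of each strand to its ending position; $b$ is pure if this permutation is the identity, and $\mathfrak{P}_N\le\mathfrak{B}_N$ is the subgroup of pure braids. *)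

theory Defs
  imports
    "HOL-Algebra.Group"
    "HOL-Combinatorics.Transposition"
    "Jordan_Normal_Form.Matrix"
begin

(* Positions, strands and matrix rows/columns are numbered 0, ..., N - 1.  So Pos i is the
   generator that crosses the strands at positions i and Suc i, i.e. sigma_(i+1) in the
   1-based numbering, and Neg i is its inverse.  Words are read from the top of the braid
   downwards. *)

datatype artin_letter = Pos (idx: nat) | Neg (idx: nat)

definition braid_words :: "nat \<Rightarrow> artin_letter list set" where
  "braid_words N = {w. \<forall>x \<in> set w. Suc (idx x) < N}"

inductive braid_eq :: "nat \<Rightarrow> artin_letter list \<Rightarrow> artin_letter list \<Rightarrow> bool" for N where
  refl: "w \<in> braid_words N \<Longrightarrow> braid_eq N w w"
| sym: "braid_eq N u v \<Longrightarrow> braid_eq N v u"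
| trans: "braid_eq N u v \<Longrightarrow> braid_eq N v w \<Longrightarrow> braid_eq N u w"
| append: "braid_eq N u u' \<Longrightarrow> braid_eq N v v' \<Longrightarrow> braid_eq N (u @ v) (u' @ v')"
| cancel_Pos_Neg: "Suc i < N \<Longrightarrow> braid_eq N [Pos i, Neg i] []"
| cancel_Neg_Pos: "Suc i < N \<Longrightarrow> braid_eq N [Neg i, Pos i] []"
| far_commute: "i + 2 \<le> j \<Longrightarrow> Suc j < N \<Longrightarrow> braid_eq N [Pos i, Pos j] [Pos j, Pos i]"
| braid: "Suc (Suc i) < N \<Longrightarrow>
    braid_eq N [Pos i, Pos (Suc i), Pos i] [Pos (Suc i), Pos i, Pos (Suc i)]"

definition braid_rel :: "nat \<Rightarrow> (artin_letter list \<times> artin_letter list) set" where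
  "braid_rel N = {(u, v). braid_eq N u v}"

definition braid_class :: "nat \<Rightarrow> artin_letter list \<Rightarrow> artin_letter list set" where
  "braid_class N w = braid_rel N `` {w}"

definition braid_group :: "nat \<Rightarrow> artin_letter list set monoid" where
  "braid_group N =
     \<lparr>carrier = braid_words N // braid_rel N,
      mult = (\<lambda>a b. \<Union>u\<in>a. \<Union>v\<in>b. braid_class N (u @ v)),
      one = braid_class N []\<rparr>"

(* word_perm w s is the position, below the word w, of the strand that starts at position s. *)

definition word_perm :: "artin_letter list \<Rightarrow> nat \<Rightarrow> nat" where
  "word_perm w = fold (\<lambda>x. transpose (idx x) (Suc (idx x))) w"

(* The level k of w is a positive crossing of strand i over strand j iff strand i is then at the
   position m of the letter Pos m, and strand j is just to the right of it.  In a negative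
   crossing Neg m the over strand is the right one, at Suc m.  Both sets are empty for i = j. *)

definition pos_crossings :: "artin_letter list \<Rightarrow> nat \<Rightarrow> nat \<Rightarrow> nat set" where
  "pos_crossings w i j = {k. k < length w \<and>
     (\<exists>m. w ! k = Pos m \<and> word_perm (take k w) i = m \<and> word_perm (take k w) j = Suc m)}"

definition neg_crossings :: "artin_letter list \<Rightarrow> nat \<Rightarrow> nat \<Rightarrow> nat set" where
  "neg_crossings w i j = {k. k < length w \<and>
     (\<exists>m. w ! k = Neg m \<and> word_perm (take k w) i = Suc m \<and> word_perm (take k w) j = m)}"

definition word_crossing :: "artin_letter list \<Rightarrow> nat \<Rightarrow> nat \<Rightarrow> int" where
  "word_crossing w i j = int (card (pos_crossings w i j)) - int (card (neg_crossings w i j))"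

definition word_crossing_matrix :: "nat \<Rightarrow> artin_letter list \<Rightarrow> int mat" where
  "word_crossing_matrix N w = mat N N (\<lambda>(i, j). word_crossing w i j)"

(* By the lemmas braid_perm_class and crossing_matrix_class below, the values on a word depend
   only on its class, so the images under the_elem are singletons. *)

definition braid_perm :: "artin_letter list set \<Rightarrow> nat \<Rightarrow> nat" where
  "braid_perm b = the_elem (word_perm ` b)"

definition crossing_matrix :: "nat \<Rightarrow> artin_letter list set \<Rightarrow> int mat" where
  "crossing_matrix N b = the_elem (word_crossing_matrix N ` b)"

definition pure_braids :: "nat \<Rightarrow> artin_letter list set set" where
  "pure_braids N = {b \<in> carrier (braid_group N). braid_perm b = id}"

definition symmetric_zero_diag_mats :: "nat \<Rightarrow> int mat set" where
  "symmetric_zero_diag_mats N =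
     {A \<in> carrier_mat N N. transpose_mat A = A \<and> (\<forall>i<N. A $$ (i, i) = 0)}"


lemma braid_words_Nil [simp]: "[] \<in> braid_words N"
  and braid_words_Cons [simp]: "x # w \<in> braid_words N \<longleftrightarrow> Suc (idx x) < N \<and> w \<in> braid_words N"
  and braid_words_append [simp]:
    "u @ v \<in> braid_words N \<longleftrightarrow> u \<in> braid_words N \<and> v \<in> braid_words N"
  by (auto simp: braid_words_def)

lemma braid_eq_words: "braid_eq N u v \<Longrightarrow> u \<in> braid_words N \<and> v \<in> braid_words N"
  by (induction rule: braid_eq.induct) auto

lemma equiv_braid_rel: "equiv (braid_words N) (braid_rel N)"
  by (rule equivI)
    (auto simp: braid_rel_def refl_on_def sym_def trans_def dest: braid_eq_words
      intro: braid_eq.refl braid_eq.sym braid_eq.trans)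

lemma mem_braid_class: "v \<in> braid_class N u \<longleftrightarrow> braid_eq N u v"
  by (simp add: braid_class_def braid_rel_def)

lemma braid_class_eqI: "braid_eq N u v \<Longrightarrow> braid_class N u = braid_class N v"
  unfolding set_eq_iff mem_braid_class by (meson braid_eq.sym braid_eq.trans)

lemma carrier_braid_group: "carrier (braid_group N) = braid_class N ` braid_words N"
  by (auto simp: braid_group_def quotient_def braid_class_def)

lemma mult_braid_class:
  assumes "u \<in> braid_words N" "v \<in> braid_words N"
  shows "braid_class N u \<otimes>\<^bsub>braid_group N\<^esub> braid_class N v = braid_class N (u @ v)"
proof -
  have *: "braid_class N (u' @ v') = braid_class N (u @ v)"
    if "u' \<in> braid_class N u" "v' \<in> braid_class N v" for u' v'
    by (rule braid_class_eqI[OF braid_eq.sym[OF braid_eq.append]])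
      (use that in \<open>simp_all add: mem_braid_class\<close>)
  have "u \<in> braid_class N u" "v \<in> braid_class N v"
    using assms by (simp_all add: mem_braid_class braid_eq.refl)
  then have "braid_class N u \<noteq> {}" "braid_class N v \<noteq> {}"
    by blast+
  moreover have "braid_class N u \<otimes>\<^bsub>braid_group N\<^esub> braid_class N v =
      (\<Union>u'\<in>braid_class N u. \<Union>v'\<in>braid_class N v. braid_class N (u @ v))"
    by (simp add: braid_group_def * cong: SUP_cong)
  ultimately show ?thesis
    by simp
qed

fun inv_letter :: "artin_letter \<Rightarrow> artin_letter" where
  "inv_letter (Pos i) = Neg i"
| "inv_letter (Neg i) = Pos i"

lemma idx_inv_letter [simp]: "idx (inv_letter x) = idx x"
  by (cases x) auto

definition inv_word :: "artin_letter list \<Rightarrow> artin_letter list" where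
  "inv_word w = rev (map inv_letter w)"

lemma inv_word_words [simp]: "inv_word w \<in> braid_words N \<longleftrightarrow> w \<in> braid_words N"
  by (auto simp: inv_word_def braid_words_def)

lemma braid_eq_inv_word: "w \<in> braid_words N \<Longrightarrow> braid_eq N (inv_word w @ w) []"
proof (induction w)
  case Nil
  then show ?case by (simp add: inv_word_def braid_eq.refl)
next
  case (Cons x w)
  have "braid_eq N [inv_letter x, x] []"
    using Cons.prems by (cases x) (auto intro: braid_eq.intros)
  moreover have "braid_eq N w w" "braid_eq N (inv_word w) (inv_word w)"
    using Cons.prems by (auto intro: braid_eq.refl)
  ultimately have "braid_eq N (inv_word w @ [inv_letter x, x] @ w) (inv_word w @ [] @ w)"
    by (intro braid_eq.append)
  then have "braid_eq N (inv_word (x # w) @ x # w) (inv_word w @ w)"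
    by (simp add: inv_word_def)
  then show ?case
    using Cons by (auto intro: braid_eq.trans)
qed

lemma one_braid_group: "\<one>\<^bsub>braid_group N\<^esub> = braid_class N []"
  by (simp add: braid_group_def)

lemma group_braid_group: "group (braid_group N)"
proof (rule groupI)
  fix a assume "a \<in> carrier (braid_group N)"
  then obtain w where w: "a = braid_class N w" "w \<in> braid_words N"
    by (auto simp: carrier_braid_group)
  then have "braid_class N (inv_word w) \<otimes>\<^bsub>braid_group N\<^esub> a = \<one>\<^bsub>braid_group N\<^esub>"
    by (simp add: mult_braid_class one_braid_group braid_class_eqI braid_eq_inv_word)
  then show "\<exists>b\<in>carrier (braid_group N). b \<otimes>\<^bsub>braid_group N\<^esub> a = \<one>\<^bsub>braid_group N\<^esub>"
    using w by (auto simp: carrier_braid_group)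
qed (auto simp: carrier_braid_group one_braid_group mult_braid_class)

lemma word_perm_Nil [simp]: "word_perm [] s = s"
  and word_perm_Cons [simp]:
    "word_perm (x # w) s = word_perm w (transpose (idx x) (Suc (idx x)) s)"
  and word_perm_append [simp]: "word_perm (u @ v) s = word_perm v (word_perm u s)"
  by (simp_all add: word_perm_def)

lemma word_crossing_Nil [simp]: "word_crossing [] i j = 0"
  by (simp add: word_crossing_def pos_crossings_def neg_crossings_def)

lemma card_less_Suc_split:
  "card {k. k < Suc n \<and> P k} = (if P 0 then 1 else 0) + card {k. k < n \<and> P (Suc k)}"
proof -
  have "{k. k < Suc n \<and> P k} = (if P 0 then {0} else {}) \<union> Suc ` {k. k < n \<and> P (Suc k)}"
    by (auto simp: image_iff less_Suc_eq_0_disj)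
  moreover have "card (Suc ` {k. k < n \<and> P (Suc k)}) = card {k. k < n \<and> P (Suc k)}"
    by (simp add: card_image)
  ultimately show ?thesis
    by (auto simp: card_insert_if)
qed

lemma word_crossing_Cons [simp]:
  "word_crossing (x # w) i j =
     (case x of Pos m \<Rightarrow> if i = m \<and> j = Suc m then 1 else 0
              | Neg m \<Rightarrow> if i = Suc m \<and> j = m then -1 else 0)
     + word_crossing w (word_perm [x] i) (word_perm [x] j)"
  unfolding word_crossing_def pos_crossings_def neg_crossings_def length_Cons
    card_less_Suc_split
  by (cases x) auto

lemma word_crossing_append:
  "word_crossing (u @ v) i j = word_crossing u i j + word_crossing v (word_perm u i) (word_perm u j)"
  by (induction u arbitrary: i j) auto

lemma braid_eq_invariants:
  "braid_eq N u v \<Longrightarrow> word_perm u = word_perm v \<and> word_crossing u = word_crossing v"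
proof (induction rule: braid_eq.induct)
  case (append u u' v v')
  then show ?case by (auto simp: fun_eq_iff word_crossing_append)
next
  case (far_commute i j)
  then show ?case by (auto simp: fun_eq_iff transpose_def)
next
  case (braid i)
  then show ?case by (auto simp: fun_eq_iff transpose_def)
qed (auto simp: fun_eq_iff transpose_def)

lemma braid_perm_class:
  assumes "w \<in> braid_words N"
  shows "braid_perm (braid_class N w) = word_perm w"
proof -
  have "word_perm ` braid_class N w = {word_perm w}"
    using assms braid_eq_invariants braid_eq.refl by (fastforce simp: mem_braid_class)
  then show ?thesis by (simp add: braid_perm_def)
qed

lemma crossing_matrix_class:
  assumes "w \<in> braid_words N"
  shows "crossing_matrix N (braid_class N w) = word_crossing_matrix N w"
proof -
  have "word_crossing_matrix N v = word_crossing_matrix N w" if "braid_eq N w v" for v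
    using braid_eq_invariants[OF that] by (simp add: word_crossing_matrix_def)
  moreover have "w \<in> braid_class N w"
    using assms by (simp add: mem_braid_class braid_eq.refl)
  ultimately have "word_crossing_matrix N ` braid_class N w = {word_crossing_matrix N w}"
    unfolding mem_braid_class[symmetric] by blast
  then show ?thesis by (simp add: crossing_matrix_def)
qed

lemma pure_braids_eq:
  "pure_braids N = braid_class N ` {w \<in> braid_words N. word_perm w = id}"
  by (auto simp: pure_braids_def carrier_braid_group braid_perm_class)

lemma subgroup_pure_braids: "subgroup (pure_braids N) (braid_group N)"
proof -
  interpret group "braid_group N" by (rule group_braid_group)
  have perm_inv: "word_perm (inv_word w) = id" if "w \<in> braid_words N" "word_perm w = id" for w
  proof -
    have "word_perm (inv_word w @ w) = word_perm []"
      using braid_eq_invariants[OF braid_eq_inv_word[OF that(1)]] by blast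
    then show ?thesis
      using that(2) by (simp add: fun_eq_iff)
  qed
  have inv_class: "inv\<^bsub>braid_group N\<^esub> (braid_class N w) = braid_class N (inv_word w)"
    if "w \<in> braid_words N" for w
  proof (rule inv_equality)
    show "braid_class N (inv_word w) \<otimes>\<^bsub>braid_group N\<^esub> braid_class N w = \<one>\<^bsub>braid_group N\<^esub>"
      using that braid_class_eqI[OF braid_eq_inv_word[OF that]]
      by (simp add: mult_braid_class one_braid_group)
  qed (use that in \<open>simp_all add: carrier_braid_group\<close>)
  show ?thesis
  proof (rule subgroupI)
    have "braid_class N [] \<in> pure_braids N"
      unfolding pure_braids_eq by (rule imageI) (simp add: fun_eq_iff)
    then show "pure_braids N \<noteq> {}"
      by blast
  next
    fix a assume "a \<in> pure_braids N"
    then obtain w where "a = braid_class N w" "w \<in> braid_words N" "word_perm w = id"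
      unfolding pure_braids_eq by blast
    then show "inv\<^bsub>braid_group N\<^esub> a \<in> pure_braids N"
      unfolding pure_braids_eq by (simp add: inv_class perm_inv)
  next
    fix a b assume "a \<in> pure_braids N" "b \<in> pure_braids N"
    then obtain u v where
      "a = braid_class N u" "u \<in> braid_words N" "word_perm u = id"
      "b = braid_class N v" "v \<in> braid_words N" "word_perm v = id"
      unfolding pure_braids_eq by blast
    moreover from this have "word_perm (u @ v) = id"
      by (simp add: fun_eq_iff)
    ultimately show "a \<otimes>\<^bsub>braid_group N\<^esub> b \<in> pure_braids N"
      unfolding pure_braids_eq by (simp add: mult_braid_class)
  qed (auto simp: pure_braids_def)
qed

lemma subgroup_symmetric_zero_diag_mats:
  "subgroup (symmetric_zero_diag_mats N) (monoid_mat TYPE(int) N N)"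
proof -
  interpret comm_group "monoid_mat TYPE(int) N N" by (rule comm_group_mat)
  have inv: "inv\<^bsub>monoid_mat TYPE(int) N N\<^esub> A = - A" if "A \<in> carrier_mat N N" for A
    using that by (intro inv_equality) (auto simp: monoid_mat_def)
  have sel: "carrier (monoid_mat TYPE(int) N N) = carrier_mat N N"
    "A \<otimes>\<^bsub>monoid_mat TYPE(int) N N\<^esub> B = A + B" for A B
    by (simp_all add: monoid_mat_def)
  show ?thesis
    by (rule subgroupI)
      (auto simp: symmetric_zero_diag_mats_def inv sel transpose_add transpose_uminus
        intro: exI[of _ "0\<^sub>m N N"])
qed

end

theory Submission imports Defs begin

text \<open>
  Why the image is contained in the symmetric matrices: each crossing of strands \<open>i\<close> and \<open>j\<close>
  interchanges their left-right order.  With its sign, it contributes to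
  \<open>C i j - C j i\<close> exactly the decrease in the truth value, read as 0 or 1, of ``\<open>i\<close> is to the left
  of \<open>j\<close>'', so this difference telescopes (\<open>word_crossing_asymmetry\<close>) and vanishes when every strand returns to
  its starting position.

  Why every such matrix occurs: on pure braids the crossing matrix is additive, so the matrices
  obtained form a group, and it suffices to obtain the symmetric matrix units
  \<open>E i j + E j i\<close>.  Two adjacent strands give such a unit by the full twist \<open>Pos i, Pos i\<close>.
  Conjugating a pure word only renumbers the strands (\<open>word_crossing_conjugate\<close>), which carries
  adjacent strands to an arbitrary pair: these are the usual generators of the pure braid group
  (\<open>ex_pure_word_unit\<close>).
\<close>

definition pure_words :: "nat \<Rightarrow> artin_letter list set" where
  "pure_words N = {w \<in> braid_words N. \<forall>s. word_perm w s = s}"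

lemma pure_braids_pure_words: "pure_braids N = braid_class N ` pure_words N"
  by (auto simp: pure_braids_eq pure_words_def fun_eq_iff)

lemma crossing_matrix_image_pure_braids:
  "crossing_matrix N ` pure_braids N = word_crossing_matrix N ` pure_words N"
  by (auto simp: pure_braids_pure_words image_image pure_words_def crossing_matrix_class
      intro!: image_cong)


lemma word_crossing_diag: "word_crossing w i i = 0"
  by (induction w arbitrary: i) (auto split: artin_letter.split)

text \<open>
  A transposition of adjacent positions preserves the order of any two strands except the two that
  it crosses, and for those the sign of the crossing and the choice of the over strand together
  record the direction in which the order changes.
\<close>

lemma word_crossing_asymmetry:
  "word_crossing w i j - word_crossing w j i
     = of_bool (i < j) - of_bool (word_perm w i < word_perm w j)"
proof (induction w arbitrary: i j)
  case Nil
  then show ?case by simp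
next
  case (Cons x w)
  let ?t = "transpose (idx x) (Suc (idx x))"
  have "word_crossing [x] i j - word_crossing [x] j i
      = of_bool (i < j) - of_bool (?t i < ?t j)"
    by (cases x) (auto simp: transpose_def)
  moreover have "word_crossing (x # w) a b
      = word_crossing [x] a b + word_crossing w (?t a) (?t b)" for a b
    using word_crossing_append[of "[x]" w] by simp
  ultimately show ?case
    using Cons[of "?t i" "?t j"] by simp
qed

lemma word_crossing_sym_pure:
  assumes "w \<in> pure_words N"
  shows "word_crossing w i j = word_crossing w j i"
  using word_crossing_asymmetry[of w i j] assms by (simp add: pure_words_def)


lemma Nil_pure_word: "[] \<in> pure_words N"
  by (simp add: pure_words_def)

lemma append_pure_word:
  "u \<in> pure_words N \<Longrightarrow> v \<in> pure_words N \<Longrightarrow> u @ v \<in> pure_words N"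
  by (simp add: pure_words_def)

lemma word_crossing_append_pure:
  assumes "u \<in> pure_words N"
  shows "word_crossing (u @ v) i j = word_crossing u i j + word_crossing v i j"
  using assms by (simp add: pure_words_def word_crossing_append)

lemma inv_pure_word:
  assumes "w \<in> pure_words N"
  shows "inv_word w \<in> pure_words N" and "word_crossing (inv_word w) i j = - word_crossing w i j"
proof -
  have w: "w \<in> braid_words N" "\<And>s. word_perm w s = s"
    using assms by (auto simp: pure_words_def)
  have inv: "word_perm (inv_word w @ w) = word_perm []"
      "word_crossing (inv_word w @ w) = word_crossing []"
    using braid_eq_invariants[OF braid_eq_inv_word[OF w(1)]] by blast+
  have perm: "word_perm (inv_word w) s = s" for s
    using fun_cong[OF inv(1), of s] by (simp add: w(2))
  show "inv_word w \<in> pure_words N"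
    using w(1) perm by (simp add: pure_words_def)
  show "word_crossing (inv_word w) i j = - word_crossing w i j"
    using fun_cong[OF fun_cong[OF inv(2)], of i j]
    by (simp add: word_crossing_append perm)
qed

lemma ex_pure_word_multiple:
  assumes "w \<in> pure_words N"
  shows "\<exists>v \<in> pure_words N. \<forall>i j. word_crossing v i j = c * word_crossing w i j"
proof (induction c rule: int_induct[where k = 0])
  case base
  show ?case
    by (rule bexI[OF _ Nil_pure_word]) simp
next
  case (step1 c)
  then obtain v where v: "v \<in> pure_words N"
      "\<And>i j. word_crossing v i j = c * word_crossing w i j"
    by blast
  show ?case
    by (rule bexI[of _ "v @ w"])
      (simp_all add: v assms append_pure_word word_crossing_append_pure[OF v(1)] algebra_simps)
next
  case (step2 c)
  then obtain v where v: "v \<in> pure_words N"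
      "\<And>i j. word_crossing v i j = c * word_crossing w i j"
    by blast
  show ?case
    by (rule bexI[of _ "v @ inv_word w"])
      (simp_all add: v assms append_pure_word inv_pure_word[OF assms] word_crossing_append_pure[OF v(1)]
        algebra_simps)
qed


text \<open>
  The crossings of \<open>u\<close> are undone by those of its inverse, because the pure word in the middle
  returns the strands to the positions where \<open>u\<close> left them.  What remains are the crossings of
  \<open>w\<close>, in which strand \<open>i\<close> takes part under its position below \<open>u\<close>.
\<close>

lemma word_crossing_conjugate:
  assumes w: "w \<in> pure_words N" and cancel: "braid_eq N (u @ u') []"
  shows "u @ w @ u' \<in> pure_words N"
    and "word_crossing (u @ w @ u') i j = word_crossing w (word_perm u i) (word_perm u j)"
proof -
  have inv: "word_perm (u @ u') = word_perm []" "word_crossing (u @ u') = word_crossing []"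
    using braid_eq_invariants[OF cancel] by blast+
  have pw: "w \<in> braid_words N" "\<And>s. word_perm w s = s"
    using w by (auto simp: pure_words_def)
  have uu': "u @ u' \<in> braid_words N"
    using braid_eq_words[OF cancel] by blast
  have "word_perm u' (word_perm u s) = s" for s
    using fun_cong[OF inv(1), of s] by simp
  then show "u @ w @ u' \<in> pure_words N"
    using uu' by (simp add: pw pure_words_def)
  have "word_crossing u i j + word_crossing u' (word_perm u i) (word_perm u j) = 0"
    using fun_cong[OF fun_cong[OF inv(2)], of i j] by (simp add: word_crossing_append)
  then show "word_crossing (u @ w @ u') i j = word_crossing w (word_perm u i) (word_perm u j)"
    by (simp add: word_crossing_append pw)
qed

text \<open>
  Starting from the full twist of the adjacent strands \<open>i\<close> and \<open>Suc i\<close>, each conjugation by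
  \<open>Pos j\<close> replaces strand \<open>j\<close> by strand \<open>Suc j\<close> in the linked pair.
\<close>

lemma ex_pure_word_unit:
  assumes "i < j" "j < N"
  shows "\<exists>w \<in> pure_words N. \<forall>a b. word_crossing w a b = of_bool ({a, b} = {i, j})"
proof -
  have "Suc i \<le> j"
    using assms(1) by simp
  then show ?thesis
    using assms(2)
  proof (induction j rule: dec_induct)
    case base
    then show ?case
      by (intro bexI[of _ "[Pos i, Pos i]"])
        (auto simp: pure_words_def doubleton_eq_iff transpose_def)
  next
    case (step j)
    then obtain w where w: "w \<in> pure_words N"
        "\<And>a b. word_crossing w a b = of_bool ({a, b} = {i, j})"
      by auto
    have "braid_eq N ([Pos j] @ [Neg j]) []"
      using step.prems by (simp add: braid_eq.cancel_Pos_Neg)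
    note conj = word_crossing_conjugate[OF w(1) this]
    let ?t = "transpose j (Suc j)"
    have "{?t a, ?t b} = {i, j} \<longleftrightarrow> {a, b} = {i, Suc j}" for a b
      using step.hyps by (auto simp: doubleton_eq_iff transpose_def split: if_splits)
    then show ?case
      using conj by (intro bexI[of _ "[Pos j] @ w @ [Neg j]"]) (simp_all add: w(2))
  qed
qed

text \<open>
  Appending a multiple of a matrix unit changes a single pair of symmetric entries, so these can be
  prescribed independently.  The pair \<open>(min a b, max a b)\<close> is the position above the diagonal that
  represents the entries at \<open>(a, b)\<close> and \<open>(b, a)\<close>.
\<close>

lemma ex_pure_word_upper_entries:
  assumes "finite S" "S \<subseteq> {(i, j). i < j \<and> j < N}"
  shows "\<exists>w \<in> pure_words N. \<forall>a b. word_crossing w a b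
    = (if (min a b, max a b) \<in> S then f (min a b) (max a b) else 0)"
  using assms
proof (induction S)
  case empty
  show ?case
    by (rule bexI[OF _ Nil_pure_word]) simp
next
  case (insert p S)
  obtain i j where p: "p = (i, j)" "i < j" "j < N"
    using insert.prems by auto
  obtain w where w: "w \<in> pure_words N"
      "\<And>a b. word_crossing w a b
        = (if (min a b, max a b) \<in> S then f (min a b) (max a b) else 0)"
    using insert by auto
  obtain e where e: "e \<in> pure_words N"
      "\<And>a b. word_crossing e a b = of_bool ({a, b} = {i, j})"
    using ex_pure_word_unit[OF p(2,3)] by blast
  obtain v where v: "v \<in> pure_words N"
      "\<And>a b. word_crossing v a b = f i j * word_crossing e a b"
    using ex_pure_word_multiple[OF e(1)] by blast
  have pair: "{a, b} = {i, j} \<longleftrightarrow> (min a b, max a b) = (i, j)" for a b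
    using p(2) by (auto simp: doubleton_eq_iff min_def max_def)
  have "word_crossing (w @ v) a b
      = (if (min a b, max a b) \<in> insert p S then f (min a b) (max a b) else 0)" for a b
    using insert.hyps(2)
    by (auto simp: word_crossing_append_pure[OF w(1)] w(2) v(2) e(2) pair p(1))
  then show ?case
    using append_pure_word[OF w(1) v(1)] by blast
qed

theorem proposition10:
  fixes N :: nat
  assumes "N \<ge> 1"
  shows "crossing_matrix N ` pure_braids N = symmetric_zero_diag_mats N"
  unfolding crossing_matrix_image_pure_braids
proof
  show "word_crossing_matrix N ` pure_words N \<subseteq> symmetric_zero_diag_mats N"
    by (auto simp: symmetric_zero_diag_mats_def word_crossing_matrix_def word_crossing_diag
        intro!: eq_matI word_crossing_sym_pure)
next
  show "symmetric_zero_diag_mats N \<subseteq> word_crossing_matrix N ` pure_words N"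
  proof
    fix A assume "A \<in> symmetric_zero_diag_mats N"
    then have A: "A \<in> carrier_mat N N" "transpose_mat A = A" "\<And>i. i < N \<Longrightarrow> A $$ (i, i) = 0"
      by (auto simp: symmetric_zero_diag_mats_def)
    have sym: "A $$ (a, b) = A $$ (b, a)" if "a < N" "b < N" for a b
      using that A(1) arg_cong[OF A(2), of "\<lambda>M. M $$ (a, b)"] by simp
    let ?S = "{(i, j). i < j \<and> j < N}"
    have "finite ?S"
      by (rule finite_subset[of _ "{..<N} \<times> {..<N}"]) auto
    then obtain w where w: "w \<in> pure_words N"
        "\<And>a b. word_crossing w a b
          = (if (min a b, max a b) \<in> ?S then A $$ (min a b, max a b) else 0)"
      using ex_pure_word_upper_entries[of ?S N "\<lambda>i j. A $$ (i, j)"] by blast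
    have "word_crossing w a b = A $$ (a, b)" if "a < N" "b < N" for a b
      using that A(3) sym[OF that] by (cases a b rule: linorder_cases) (auto simp: w(2))
    then have "word_crossing_matrix N w = A"
      using A(1) by (auto simp: word_crossing_matrix_def)
    then show "A \<in> word_crossing_matrix N ` pure_words N"
      using w(1) by blast
  qed
qed

end
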